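(* Let $T$ be a complete first-order theory in a countable language $L$ with monster model $\mathfrak{C}$, and let $A\subseteq\mathfrak{C}$ be a parameter set. Let $\mathcal{U}$ be a regular ultrafilter on a cardinal $\lambda$, and let $p\subseteq\mathscr{F}(A)$ be a flat and definable FN basis satisfying Property B. Then $p^{\mathcal{U}}$ is flat, and for every $B$ with $A\subseteq B\subseteq\mathfrak{C}$, $p^{\mathcal{U}}$ admits a unique nonforking heir over $B$.
   Context: $\mathfrak{C}$ is a sufficiently saturated and strongly homogeneous model of $T$. For a parameter set $A$, $\mathscr{F}(A)$ is the Boolean algebra of formulas $\varphi(x)$ over $A$ (with parameters from $A$) modulo the equivalence $\varphi\sim\psi$ iff $T\models\varphi\leftrightarrow\psi$. A filter on $\mathscr{F}(A)$ is a subset $p\subseteq\mathscr{F}(A)$ closed under finite intersections (conjunctions) and supersets (weaker formulas in $\mathscr{F}(A)$). A filter $p$ is finitely satisfiable in $A$ if every finite subset of $p$ is realized by an element of $A$. A filter $p$ is flat if for every finite $\Gamma\subseteq p$ there are an elementary extension $\mathcal{M}\succ A$ (a model of $T$ containing $A$ in which the elements of $A$ satisfy the same $L$-formulas as in $\mathfrak{C}$) and an element $a\in\mathcal{M}$ with $\mathcal{M}\models\varphi(a)$ for all $\varphi\in\Gamma$. A flat filter $p\subseteq\mathscr{F}(A)$ satisfies Property B if for every $\varphi(x)\in\mathscr{F}(A)$: whenever there are $\psi_1(x),\dots,\psi_n(x)\in p$ with $T\models\bigwedge_{i=1}^n\psi_i(x)\to\varphi(x)$, then $\varphi(x)\in p$.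 An FN basis over $A$ is a filter $p\subseteq\mathscr{F}(A)$ finitely satisfiable in $A$ (the closure conditions of flatness and Property B are listed explicitly in the claim). It is definable if for every $L$-formula $\varphi(x,\bar y)$ there is a formula $\theta(\bar y)$ over $A$ such that for all tuples $\bar b$ from $A$: $\varphi(x,\bar b)\in p$ iff $\mathfrak{C}\models\theta(\bar b)$. For an ultrafilter $\mathcal{U}$ on $\lambda$, $p^{\mathcal{U}}=\{\varphi\in\mathscr{F}(A):\{i<\lambda:\varphi\in p_i\}\in\mathcal{U}\}$ with $p_i=p$ for all $i<\lambda$. An ultrafilter $\mathcal{U}$ on an infinite cardinal $\lambda$ is regular if there is a family of $\lambda$ many members of $\mathcal{U}$ such that each $i<\lambda$ belongs to only finitely many of them. For a filter $r\subseteq\mathscr{F}(A)$ and $B\supseteq A$, an heir of $r$ over $B$ is a filter $q\subseteq\mathscr{F}(B)$ extending $r$ such that every $\varphi(x)\in q$ is implied by some $\psi(x)\in r$ (implication read as in $\mathscr{F}(B)$, i.e. $T\models\psi\to\varphi$). It is nonforking if no formula in it forks over $A$ in the usual sense, i.e. no formula in it implies a finite disjunction of formulas (with parameters in $\mathfrak{C}$) each of which divides over $A$. *)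

theory Defs
  imports Main "HOL-Library.Countable_Set"
begin

unbundle cardinal_syntax

section \<open>First-order logic with equality\<close>

record ('f, 'r) lang =
  funs :: "'f set"
  rels :: "'r set"
  farity :: "'f \<Rightarrow> nat"
  rarity :: "'r \<Rightarrow> nat"

datatype 'f tm = Var nat | Fn 'f "'f tm list"

datatype ('f, 'r) fm =
    Top
  | Eq "'f tm" "'f tm"
  | Rel 'r "'f tm list"
  | Neg "('f, 'r) fm"
  | And "('f, 'r) fm" "('f, 'r) fm"
  | Ex nat "('f, 'r) fm"

definition Imp :: "('f, 'r) fm \<Rightarrow> ('f, 'r) fm \<Rightarrow> ('f, 'r) fm" where
  "Imp \<phi> \<psi> = Neg (And \<phi> (Neg \<psi>))"

definition Iff :: "('f, 'r) fm \<Rightarrow> ('f, 'r) fm \<Rightarrow> ('f, 'r) fm" where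
  "Iff \<phi> \<psi> = And (Imp \<phi> \<psi>) (Imp \<psi> \<phi>)"

definition Conj :: "('f, 'r) fm list \<Rightarrow> ('f, 'r) fm" where
  "Conj \<phi>s = foldr And \<phi>s Top"

definition Disj :: "('f, 'r) fm list \<Rightarrow> ('f, 'r) fm" where
  "Disj \<phi>s = Neg (Conj (map Neg \<phi>s))"

primrec fvt :: "'f tm \<Rightarrow> nat set" where
  "fvt (Var n) = {n}"
| "fvt (Fn f ts) = \<Union> (set (map fvt ts))"

primrec fv :: "('f, 'r) fm \<Rightarrow> nat set" where
  "fv Top = {}"
| "fv (Eq s t) = fvt s \<union> fvt t"
| "fv (Rel r ts) = \<Union> (set (map fvt ts))"
| "fv (Neg \<phi>) = fv \<phi>"
| "fv (And \<phi> \<psi>) = fv \<phi> \<union> fv \<psi>"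
| "fv (Ex n \<phi>) = fv \<phi> - {n}"

fun is_tm :: "('f, 'r) lang \<Rightarrow> 'f tm \<Rightarrow> bool" where
  "is_tm L (Var n) \<longleftrightarrow> True"
| "is_tm L (Fn f ts) \<longleftrightarrow> f \<in> funs L \<and> length ts = farity L f \<and> (\<forall>t\<in>set ts. is_tm L t)"

primrec is_fm :: "('f, 'r) lang \<Rightarrow> ('f, 'r) fm \<Rightarrow> bool" where
  "is_fm L Top \<longleftrightarrow> True"
| "is_fm L (Eq s t) \<longleftrightarrow> is_tm L s \<and> is_tm L t"
| "is_fm L (Rel r ts) \<longleftrightarrow> r \<in> rels L \<and> length ts = rarity L r \<and> (\<forall>t\<in>set ts. is_tm L t)"
| "is_fm L (Neg \<phi>) \<longleftrightarrow> is_fm L \<phi>"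
| "is_fm L (And \<phi> \<psi>) \<longleftrightarrow> is_fm L \<phi> \<and> is_fm L \<psi>"
| "is_fm L (Ex n \<phi>) \<longleftrightarrow> is_fm L \<phi>"

record ('f, 'r, 'u) struct =
  univ :: "'u set"
  fint :: "'f \<Rightarrow> 'u list \<Rightarrow> 'u"
  rint :: "'r \<Rightarrow> 'u list \<Rightarrow> bool"

definition is_struct :: "('f, 'r) lang \<Rightarrow> ('f, 'r, 'u) struct \<Rightarrow> bool" where
  "is_struct L M \<longleftrightarrow> univ M \<noteq> {} \<and>
     (\<forall>f\<in>funs L. \<forall>as. set as \<subseteq> univ M \<and> length as = farity L f \<longrightarrow> fint M f as \<in> univ M)"

primrec tval :: "('f, 'r, 'u) struct \<Rightarrow> (nat \<Rightarrow> 'u) \<Rightarrow> 'f tm \<Rightarrow> 'u" where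
  "tval M s (Var n) = s n"
| "tval M s (Fn f ts) = fint M f (map (tval M s) ts)"

primrec sat :: "('f, 'r, 'u) struct \<Rightarrow> (nat \<Rightarrow> 'u) \<Rightarrow> ('f, 'r) fm \<Rightarrow> bool" where
  "sat M s Top \<longleftrightarrow> True"
| "sat M s (Eq t u) \<longleftrightarrow> tval M s t = tval M s u"
| "sat M s (Rel r ts) \<longleftrightarrow> rint M r (map (tval M s) ts)"
| "sat M s (Neg \<phi>) \<longleftrightarrow> \<not> sat M s \<phi>"
| "sat M s (And \<phi> \<psi>) \<longleftrightarrow> sat M s \<phi> \<and> sat M s \<psi>"
| "sat M s (Ex n \<phi>) \<longleftrightarrow> (\<exists>a\<in>univ M. sat M (s(n := a)) \<phi>)"

definition sentence :: "('f, 'r) lang \<Rightarrow> ('f, 'r) fm \<Rightarrow> bool" where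
  "sentence L \<sigma> \<longleftrightarrow> is_fm L \<sigma> \<and> fv \<sigma> = {}"

definition is_model :: "('f, 'r) lang \<Rightarrow> ('f, 'r) fm set \<Rightarrow> ('f, 'r, 'u) struct \<Rightarrow> bool" where
  "is_model L T M \<longleftrightarrow> is_struct L M \<and> (\<forall>\<sigma>\<in>T. \<forall>s. range s \<subseteq> univ M \<longrightarrow> sat M s \<sigma>)"

definition countable_lang :: "('f, 'r) lang \<Rightarrow> bool" where
  "countable_lang L \<longleftrightarrow> countable (funs L) \<and> countable (rels L)"

text \<open>Consequence of a theory ranges over the models whose universe is a set of natural numbers.
  By the downward Loewenheim--Skolem theorem this is the usual consequence relation,
  since all languages considered are countable.\<close>

definition consequence :: "('f, 'r) lang \<Rightarrow> ('f, 'r) fm set \<Rightarrow> ('f, 'r) fm \<Rightarrow> bool" where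
  "consequence L T \<sigma> \<longleftrightarrow>
     (\<forall>M :: ('f, 'r, nat) struct. is_model L T M \<longrightarrow> (\<forall>s. range s \<subseteq> univ M \<longrightarrow> sat M s \<sigma>))"

definition complete_theory :: "('f, 'r) lang \<Rightarrow> ('f, 'r) fm set \<Rightarrow> bool" where
  "complete_theory L T \<longleftrightarrow> (\<forall>\<sigma>\<in>T. sentence L \<sigma>) \<and>
     \<not> consequence L T (Neg Top) \<and>
     (\<forall>\<sigma>. sentence L \<sigma> \<longrightarrow> consequence L T \<sigma> \<or> consequence L T (Neg \<sigma>))"


section \<open>Formulas with parameters\<close>

text \<open>The expansion of \<open>L\<close> by a constant symbol \<open>Inr a\<close> for each \<open>a \<in> A\<close>, and the
  corresponding expansion of structures, in which \<open>Inr a\<close> denotes \<open>a\<close>.\<close>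

definition lang_over :: "('f, 'r) lang \<Rightarrow> 'c set \<Rightarrow> ('f + 'c, 'r) lang" where
  "lang_over L A = \<lparr>funs = Inl ` funs L \<union> Inr ` A, rels = rels L,
     farity = case_sum (farity L) (\<lambda>_. 0), rarity = rarity L\<rparr>"

definition named :: "('f, 'r, 'c) struct \<Rightarrow> ('f + 'c, 'r, 'c) struct" where
  "named M = \<lparr>univ = univ M, fint = case_sum (fint M) (\<lambda>a _. a), rint = rint M\<rparr>"

text \<open>Convention: the variable \<open>x\<close> is \<open>Var 0\<close>, and a tuple \<open>ys\<close> of variables of length \<open>n\<close> is
  \<open>Var 1, \<dots>, Var n\<close>. Then \<open>sat M (tup bs) \<theta>\<close> expresses \<open>M \<Turnstile> \<theta>(bs)\<close> for \<open>\<theta>(ys)\<close>, and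
  \<open>sat M (\<lambda>_. a) \<phi>\<close> expresses \<open>M \<Turnstile> \<phi>(a)\<close> for \<open>\<phi>(x)\<close>.\<close>

definition tup :: "'c list \<Rightarrow> nat \<Rightarrow> 'c" where
  "tup bs i = bs ! (i - 1)"

primrec inst_tm :: "(nat \<Rightarrow> 'c option) \<Rightarrow> 'f tm \<Rightarrow> ('f + 'c) tm" where
  "inst_tm e (Var n) = (case e n of None \<Rightarrow> Var n | Some c \<Rightarrow> Fn (Inr c) [])"
| "inst_tm e (Fn f ts) = Fn (Inl f) (map (inst_tm e) ts)"

primrec inst_fm :: "('f, 'r) fm \<Rightarrow> (nat \<Rightarrow> 'c option) \<Rightarrow> ('f + 'c, 'r) fm" where
  "inst_fm Top e = Top"
| "inst_fm (Eq s t) e = Eq (inst_tm e s) (inst_tm e t)"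
| "inst_fm (Rel r ts) e = Rel r (map (inst_tm e) ts)"
| "inst_fm (Neg \<phi>) e = Neg (inst_fm \<phi> e)"
| "inst_fm (And \<phi> \<psi>) e = And (inst_fm \<phi> e) (inst_fm \<psi> e)"
| "inst_fm (Ex n \<phi>) e = Ex n (inst_fm \<phi> (e(n := None)))"

text \<open>The formula \<open>\<phi>(x, bs)\<close> for an \<open>L\<close>-formula \<open>\<phi>(x, ys)\<close>.\<close>

definition inst :: "('f, 'r) fm \<Rightarrow> 'c list \<Rightarrow> ('f + 'c, 'r) fm" where
  "inst \<phi> bs = inst_fm \<phi> (\<lambda>i. if 1 \<le> i \<and> i \<le> length bs then Some (tup bs i) else None)"

definition forms :: "('f, 'r) lang \<Rightarrow> 'c set \<Rightarrow> ('f + 'c, 'r) fm set" where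
  "forms L A = {\<phi>. is_fm (lang_over L A) \<phi> \<and> fv \<phi> \<subseteq> {0}}"


section \<open>The monster model\<close>

definition saturated :: "('f, 'r) lang \<Rightarrow> 'k rel \<Rightarrow> ('f, 'r, 'c) struct \<Rightarrow> bool" where
  "saturated L \<kappa> C \<longleftrightarrow> (\<forall>D \<Sigma>. D \<subseteq> univ C \<and> |D| <o \<kappa> \<and> \<Sigma> \<subseteq> forms L D \<and>
     (\<forall>\<Gamma>. finite \<Gamma> \<and> \<Gamma> \<subseteq> \<Sigma> \<longrightarrow> (\<exists>a\<in>univ C. \<forall>\<phi>\<in>\<Gamma>. sat (named C) (\<lambda>_. a) \<phi>)) \<longrightarrow>
     (\<exists>a\<in>univ C. \<forall>\<phi>\<in>\<Sigma>. sat (named C) (\<lambda>_. a) \<phi>))"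

definition partial_elementary ::
    "('f, 'r) lang \<Rightarrow> ('f, 'r, 'c) struct \<Rightarrow> 'c set \<Rightarrow> ('c \<Rightarrow> 'c) \<Rightarrow> bool" where
  "partial_elementary L C D f \<longleftrightarrow> f ` D \<subseteq> univ C \<and>
     (\<forall>\<phi> as. is_fm L \<phi> \<and> set as \<subseteq> D \<and> fv \<phi> \<subseteq> {1..length as} \<longrightarrow>
        (sat C (tup as) \<phi> \<longleftrightarrow> sat C (tup (map f as)) \<phi>))"

definition automorphism ::
    "('f, 'r) lang \<Rightarrow> ('f, 'r, 'c) struct \<Rightarrow> ('c \<Rightarrow> 'c) \<Rightarrow> bool" where
  "automorphism L C g \<longleftrightarrow> bij_betw g (univ C) (univ C) \<and>
     (\<forall>f\<in>funs L. \<forall>as. set as \<subseteq> univ C \<and> length as = farity L f \<longrightarrow>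
        g (fint C f as) = fint C f (map g as)) \<and>
     (\<forall>r\<in>rels L. \<forall>as. set as \<subseteq> univ C \<and> length as = rarity L r \<longrightarrow>
        (rint C r as \<longleftrightarrow> rint C r (map g as)))"

definition strongly_homogeneous ::
    "('f, 'r) lang \<Rightarrow> 'k rel \<Rightarrow> ('f, 'r, 'c) struct \<Rightarrow> bool" where
  "strongly_homogeneous L \<kappa> C \<longleftrightarrow>
     (\<forall>D f. D \<subseteq> univ C \<and> |D| <o \<kappa> \<and> partial_elementary L C D f \<longrightarrow>
        (\<exists>g. automorphism L C g \<and> (\<forall>d\<in>D. g d = f d)))"

definition monster ::
    "('f, 'r) lang \<Rightarrow> ('f, 'r) fm set \<Rightarrow> 'k rel \<Rightarrow> ('f, 'r, 'c) struct \<Rightarrow> bool" where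
  "monster L T \<kappa> C \<longleftrightarrow> is_model L T C \<and> Card_order \<kappa> \<and> natLeq <o \<kappa> \<and>
     saturated L \<kappa> C \<and> strongly_homogeneous L \<kappa> C"


section \<open>The algebra of formulas over a parameter set\<close>

text \<open>\<open>M \<succ> A\<close>. The universe of \<open>M\<close> is a subset of the type of elements of \<open>C\<close>, but \<open>M\<close> need not
  be a substructure of \<open>C\<close>. Restricting to this type loses nothing below: satisfiability of a
  formula over \<open>A\<close> in some \<open>M \<succ> A\<close> of any size implies its satisfiability in \<open>C\<close> itself.\<close>

definition elem_ext :: "('f, 'r) lang \<Rightarrow> ('f, 'r) fm set \<Rightarrow> ('f, 'r, 'c) struct \<Rightarrow> 'c set \<Rightarrow>
    ('f, 'r, 'c) struct \<Rightarrow> bool" where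
  "elem_ext L T C A M \<longleftrightarrow> is_model L T M \<and> A \<subseteq> univ M \<and>
     (\<forall>\<phi> as. is_fm L \<phi> \<and> set as \<subseteq> A \<and> fv \<phi> \<subseteq> {1..length as} \<longrightarrow>
        (sat M (tup as) \<phi> \<longleftrightarrow> sat C (tup as) \<phi>))"

text \<open>\<open>T \<Turnstile> \<phi>\<close> for a formula \<open>\<phi>\<close> over \<open>A\<close>: as usual, the parameters carry their type in \<open>C\<close>,
  so the models of \<open>T\<close> under consideration are those \<open>M \<succ> A\<close>.\<close>

definition entails :: "('f, 'r) lang \<Rightarrow> ('f, 'r) fm set \<Rightarrow> ('f, 'r, 'c) struct \<Rightarrow> 'c set \<Rightarrow>
    ('f + 'c, 'r) fm \<Rightarrow> bool" where
  "entails L T C A \<phi> \<longleftrightarrow>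
     (\<forall>M. elem_ext L T C A M \<longrightarrow> (\<forall>s. range s \<subseteq> univ M \<longrightarrow> sat (named M) s \<phi>))"

definition form_equiv :: "('f, 'r) lang \<Rightarrow> ('f, 'r) fm set \<Rightarrow> ('f, 'r, 'c) struct \<Rightarrow> 'c set \<Rightarrow>
    ('f + 'c, 'r) fm rel" where
  "form_equiv L T C A =
     {(\<phi>, \<psi>). \<phi> \<in> forms L A \<and> \<psi> \<in> forms L A \<and> entails L T C A (Iff \<phi> \<psi>)}"

definition form_alg :: "('f, 'r) lang \<Rightarrow> ('f, 'r) fm set \<Rightarrow> ('f, 'r, 'c) struct \<Rightarrow> 'c set \<Rightarrow>
    ('f + 'c, 'r) fm set set" where
  "form_alg L T C A = forms L A // form_equiv L T C A"

definition cls :: "('f, 'r) lang \<Rightarrow> ('f, 'r) fm set \<Rightarrow> ('f, 'r, 'c) struct \<Rightarrow> 'c set \<Rightarrow>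
    ('f + 'c, 'r) fm \<Rightarrow> ('f + 'c, 'r) fm set" where
  "cls L T C A \<phi> = form_equiv L T C A `` {\<phi>}"

text \<open>The class of a formula \<open>\<phi>\<close> belongs to \<open>p\<close>; this is what \<open>\<phi> \<in> p\<close> abbreviates informally.\<close>

definition mem :: "('f, 'r) lang \<Rightarrow> ('f, 'r) fm set \<Rightarrow> ('f, 'r, 'c) struct \<Rightarrow> 'c set \<Rightarrow>
    ('f + 'c, 'r) fm \<Rightarrow> ('f + 'c, 'r) fm set set \<Rightarrow> bool" where
  "mem L T C A \<phi> p \<longleftrightarrow> \<phi> \<in> forms L A \<and> cls L T C A \<phi> \<in> p"

definition form_filter :: "('f, 'r) lang \<Rightarrow> ('f, 'r) fm set \<Rightarrow> ('f, 'r, 'c) struct \<Rightarrow> 'c set \<Rightarrow>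
    ('f + 'c, 'r) fm set set \<Rightarrow> bool" where
  "form_filter L T C A p \<longleftrightarrow> p \<subseteq> form_alg L T C A \<and>
     (\<forall>\<phi>s. (\<forall>\<phi>\<in>set \<phi>s. mem L T C A \<phi> p) \<longrightarrow> mem L T C A (Conj \<phi>s) p) \<and>
     (\<forall>\<phi> \<psi>. mem L T C A \<phi> p \<and> \<psi> \<in> forms L A \<and> entails L T C A (Imp \<phi> \<psi>) \<longrightarrow>
        mem L T C A \<psi> p)"

definition fin_sat :: "('f, 'r, 'c) struct \<Rightarrow> 'c set \<Rightarrow> ('f + 'c, 'r) fm set set \<Rightarrow> bool" where
  "fin_sat C A p \<longleftrightarrow> (\<forall>\<Gamma>. finite \<Gamma> \<and> \<Gamma> \<subseteq> p \<longrightarrow>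
     (\<exists>a\<in>A. \<forall>X\<in>\<Gamma>. \<forall>\<phi>\<in>X. sat (named C) (\<lambda>_. a) \<phi>))"

definition flat :: "('f, 'r) lang \<Rightarrow> ('f, 'r) fm set \<Rightarrow> ('f, 'r, 'c) struct \<Rightarrow> 'c set \<Rightarrow>
    ('f + 'c, 'r) fm set set \<Rightarrow> bool" where
  "flat L T C A p \<longleftrightarrow> form_filter L T C A p \<and>
     (\<forall>\<Gamma>. finite \<Gamma> \<and> \<Gamma> \<subseteq> p \<longrightarrow>
        (\<exists>M. elem_ext L T C A M \<and>
           (\<exists>a\<in>univ M. \<forall>X\<in>\<Gamma>. \<forall>\<phi>\<in>X. sat (named M) (\<lambda>_. a) \<phi>)))"

definition property_B :: "('f, 'r) lang \<Rightarrow> ('f, 'r) fm set \<Rightarrow> ('f, 'r, 'c) struct \<Rightarrow> 'c set \<Rightarrow>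
    ('f + 'c, 'r) fm set set \<Rightarrow> bool" where
  "property_B L T C A p \<longleftrightarrow> (\<forall>\<phi>\<in>forms L A.
     (\<exists>\<psi>s. (\<forall>\<psi>\<in>set \<psi>s. mem L T C A \<psi> p) \<and> entails L T C A (Imp (Conj \<psi>s) \<phi>)) \<longrightarrow>
     mem L T C A \<phi> p)"

definition fn_basis :: "('f, 'r) lang \<Rightarrow> ('f, 'r) fm set \<Rightarrow> ('f, 'r, 'c) struct \<Rightarrow> 'c set \<Rightarrow>
    ('f + 'c, 'r) fm set set \<Rightarrow> bool" where
  "fn_basis L T C A p \<longleftrightarrow> form_filter L T C A p \<and> fin_sat C A p"

definition definable :: "('f, 'r) lang \<Rightarrow> ('f, 'r) fm set \<Rightarrow> ('f, 'r, 'c) struct \<Rightarrow> 'c set \<Rightarrow>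
    ('f + 'c, 'r) fm set set \<Rightarrow> bool" where
  "definable L T C A p \<longleftrightarrow> (\<forall>n \<phi>. is_fm L \<phi> \<and> fv \<phi> \<subseteq> {0..n} \<longrightarrow>
     (\<exists>\<theta>. is_fm (lang_over L A) \<theta> \<and> fv \<theta> \<subseteq> {1..n} \<and>
        (\<forall>bs. length bs = n \<and> set bs \<subseteq> A \<longrightarrow>
           (mem L T C A (inst \<phi> bs) p \<longleftrightarrow> sat (named C) (tup bs) \<theta>))))"


section \<open>Regular ultrafilters\<close>

definition ultrafilter_on :: "'i set \<Rightarrow> 'i set set \<Rightarrow> bool" where
  "ultrafilter_on I U \<longleftrightarrow> U \<subseteq> Pow I \<and> I \<in> U \<and> {} \<notin> U \<and>
     (\<forall>X\<in>U. \<forall>Y\<in>U. X \<inter> Y \<in> U) \<and>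
     (\<forall>X\<in>U. \<forall>Y. X \<subseteq> Y \<and> Y \<subseteq> I \<longrightarrow> Y \<in> U) \<and>
     (\<forall>X. X \<subseteq> I \<longrightarrow> X \<in> U \<or> I - X \<in> U)"

definition regular_ultrafilter :: "'i rel \<Rightarrow> 'i set set \<Rightarrow> bool" where
  "regular_ultrafilter \<mu> U \<longleftrightarrow> Card_order \<mu> \<and> infinite (Field \<mu>) \<and>
     ultrafilter_on (Field \<mu>) U \<and>
     (\<exists>E. E \<subseteq> U \<and> |E| =o \<mu> \<and> (\<forall>i\<in>Field \<mu>. finite {X\<in>E. i \<in> X}))"

definition ultra_limit :: "('f, 'r) lang \<Rightarrow> ('f, 'r) fm set \<Rightarrow> ('f, 'r, 'c) struct \<Rightarrow> 'c set \<Rightarrow>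
    'i set \<Rightarrow> 'i set set \<Rightarrow> ('i \<Rightarrow> ('f + 'c, 'r) fm set set) \<Rightarrow> ('f + 'c, 'r) fm set set" where
  "ultra_limit L T C A I U ps = {X \<in> form_alg L T C A. {i\<in>I. X \<in> ps i} \<in> U}"

definition ultra_power :: "('f, 'r) lang \<Rightarrow> ('f, 'r) fm set \<Rightarrow> ('f, 'r, 'c) struct \<Rightarrow> 'c set \<Rightarrow>
    'i rel \<Rightarrow> 'i set set \<Rightarrow> ('f + 'c, 'r) fm set set \<Rightarrow> ('f + 'c, 'r) fm set set" where
  "ultra_power L T C A \<mu> U p = ultra_limit L T C A (Field \<mu>) U (\<lambda>_. p)"


section \<open>Forking and heirs\<close>

definition same_type ::
    "('f, 'r) lang \<Rightarrow> ('f, 'r, 'c) struct \<Rightarrow> 'c set \<Rightarrow> 'c list \<Rightarrow> 'c list \<Rightarrow> bool" where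
  "same_type L C A bs cs \<longleftrightarrow> length bs = length cs \<and>
     (\<forall>\<theta>. is_fm (lang_over L A) \<theta> \<and> fv \<theta> \<subseteq> {1..length bs} \<longrightarrow>
        (sat (named C) (tup bs) \<theta> \<longleftrightarrow> sat (named C) (tup cs) \<theta>))"

text \<open>The formula \<open>\<chi>(x, bs)\<close> divides over \<open>A\<close>: for some \<open>k\<close> there are realizations
  \<open>c 0, c 1, \<dots>\<close> of \<open>tp(bs / A)\<close> such that the family \<open>(\<chi>(x, c i))\<^sub>i\<close> is \<open>k\<close>-inconsistent.\<close>

definition divides :: "('f, 'r) lang \<Rightarrow> ('f, 'r, 'c) struct \<Rightarrow> 'c set \<Rightarrow>
    ('f, 'r) fm \<Rightarrow> 'c list \<Rightarrow> bool" where
  "divides L C A \<chi> bs \<longleftrightarrow> is_fm L \<chi> \<and> fv \<chi> \<subseteq> {0..length bs} \<and> set bs \<subseteq> univ C \<and>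
     (\<exists>(k::nat) (c :: nat \<Rightarrow> 'c list).
        (\<forall>i. set (c i) \<subseteq> univ C \<and> same_type L C A bs (c i)) \<and>
        (\<forall>I. finite I \<and> card I = k \<longrightarrow>
           \<not> (\<exists>a\<in>univ C. \<forall>i\<in>I. sat (named C) (\<lambda>_. a) (inst \<chi> (c i)))))"

definition forks :: "('f, 'r) lang \<Rightarrow> ('f, 'r) fm set \<Rightarrow> ('f, 'r, 'c) struct \<Rightarrow> 'c set \<Rightarrow>
    ('f + 'c, 'r) fm \<Rightarrow> bool" where
  "forks L T C A \<phi> \<longleftrightarrow> (\<exists>ds. (\<forall>(\<chi>, bs)\<in>set ds. divides L C A \<chi> bs) \<and>
     entails L T C (univ C) (Imp \<phi> (Disj (map (\<lambda>(\<chi>, bs). inst \<chi> bs) ds))))"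

definition heir :: "('f, 'r) lang \<Rightarrow> ('f, 'r) fm set \<Rightarrow> ('f, 'r, 'c) struct \<Rightarrow> 'c set \<Rightarrow>
    ('f + 'c, 'r) fm set set \<Rightarrow> 'c set \<Rightarrow> ('f + 'c, 'r) fm set set \<Rightarrow> bool" where
  "heir L T C A r B q \<longleftrightarrow> form_filter L T C B q \<and>
     (\<forall>\<phi>. mem L T C A \<phi> r \<longrightarrow> mem L T C B \<phi> q) \<and>
     (\<forall>\<phi>. mem L T C B \<phi> q \<longrightarrow> (\<exists>\<psi>. mem L T C A \<psi> r \<and> entails L T C B (Imp \<psi> \<phi>)))"

definition nonforking :: "('f, 'r) lang \<Rightarrow> ('f, 'r) fm set \<Rightarrow> ('f, 'r, 'c) struct \<Rightarrow> 'c set \<Rightarrow>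
    'c set \<Rightarrow> ('f + 'c, 'r) fm set set \<Rightarrow> bool" where
  "nonforking L T C A B q \<longleftrightarrow> (\<forall>\<phi>. mem L T C B \<phi> q \<longrightarrow> \<not> forks L T C A \<phi>)"

end

theory Submission
  imports Defs
begin

text \<open>The ultrapower of a constant family of filters is the filter itself, so flatness is inherited.
  The heir condition determines the heir: it is the filter generated by \<open>p\<close> over \<open>B\<close>. It does not
  fork, because each of its formulas is realized by some \<open>a \<in> A\<close>, and a formula \<open>\<chi>(x, bs)\<close> realized
  by \<open>a \<in> A\<close> cannot divide over \<open>A\<close>: the formula \<open>\<chi>(a, ys)\<close> belongs to \<open>tp(bs / A)\<close>, so that \<open>a\<close>
  realizes \<open>\<chi>(x, cs)\<close> for every realization \<open>cs\<close> of this type.\<close>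

section \<open>Syntax and satisfaction\<close>

lemma sat_Imp [simp]: "sat M s (Imp \<phi> \<psi>) \<longleftrightarrow> (sat M s \<phi> \<longrightarrow> sat M s \<psi>)"
  by (simp add: Imp_def)

lemma sat_Iff [simp]: "sat M s (Iff \<phi> \<psi>) \<longleftrightarrow> (sat M s \<phi> \<longleftrightarrow> sat M s \<psi>)"
  by (auto simp: Iff_def)

lemma sat_Conj [simp]: "sat M s (Conj \<phi>s) \<longleftrightarrow> (\<forall>\<phi>\<in>set \<phi>s. sat M s \<phi>)"
  unfolding Conj_def by (induction \<phi>s) auto

lemma sat_Disj [simp]: "sat M s (Disj \<phi>s) \<longleftrightarrow> (\<exists>\<phi>\<in>set \<phi>s. sat M s \<phi>)"
  by (simp add: Disj_def)

lemma tval_cong: "(\<And>n. n \<in> fvt t \<Longrightarrow> s n = s' n) \<Longrightarrow> tval M s t = tval M s' t"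
proof (induction t)
  case (Fn f ts)
  have "map (tval M s) ts = map (tval M s') ts"
    using Fn by (intro map_cong) auto
  then show ?case by (simp only: tval.simps)
qed simp

lemma sat_cong: "(\<And>n. n \<in> fv \<phi> \<Longrightarrow> s n = s' n) \<Longrightarrow> sat M s \<phi> \<longleftrightarrow> sat M s' \<phi>"
proof (induction \<phi> arbitrary: s s')
  case (Eq t u)
  then show ?case by (simp add: tval_cong[of t s s'] tval_cong[of u s s'])
next
  case (Rel r ts)
  have "map (tval M s) ts = map (tval M s') ts"
    using Rel by (intro map_cong) (auto intro!: tval_cong)
  then show ?case by (simp only: sat.simps)
next
  case (Neg \<phi>)
  then show ?case by (metis fv.simps(4) sat.simps(4))
next
  case (And \<phi> \<psi>)
  then show ?case by (metis UnCI fv.simps(5) sat.simps(5))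
next
  case (Ex n \<phi>)
  have "sat M (s(n := a)) \<phi> \<longleftrightarrow> sat M (s'(n := a)) \<phi>" for a
    using Ex.prems by (intro Ex.IH) auto
  then show ?case by simp
qed simp

lemma is_tm_lang_over_mono:
  "A \<subseteq> B \<Longrightarrow> is_tm (lang_over L A) t \<Longrightarrow> is_tm (lang_over L B) t"
  by (induction t) (auto simp: lang_over_def)

lemma is_fm_lang_over_mono:
  "A \<subseteq> B \<Longrightarrow> is_fm (lang_over L A) \<phi> \<Longrightarrow> is_fm (lang_over L B) \<phi>"
proof (induction \<phi>)
  case (Rel r ts)
  then show ?case
    using is_tm_lang_over_mono[of A B L] by (auto simp: lang_over_def)
qed (auto intro: is_tm_lang_over_mono)

lemma forms_mono: "A \<subseteq> B \<Longrightarrow> forms L A \<subseteq> forms L B"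
  by (auto simp: forms_def is_fm_lang_over_mono)

lemma Conj_in_forms: "set \<phi>s \<subseteq> forms L A \<Longrightarrow> Conj \<phi>s \<in> forms L A"
  unfolding Conj_def by (induction \<phi>s) (auto simp: forms_def)

section \<open>Instantiating variables by parameters\<close>

lemma tval_inst_tm:
  "tval (named M) s (inst_tm e t) = tval M (\<lambda>n. case e n of None \<Rightarrow> s n | Some c \<Rightarrow> c) t"
proof (induction t)
  case (Var n)
  then show ?case by (simp add: named_def split: option.split)
next
  case (Fn f ts)
  then have "map (tval (named M) s) (map (inst_tm e) ts) =
      map (tval M (\<lambda>n. case e n of None \<Rightarrow> s n | Some c \<Rightarrow> c)) ts"
    by simp
  moreover have "fint (named M) (Inl f) = fint M f"
    by (simp add: named_def)
  ultimately show ?case by (simp only: tval.simps inst_tm.simps)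
qed

text \<open>Only constants are substituted, so no variable is captured; as \<open>Inr c\<close>
  denotes \<open>c\<close> in \<open>named M\<close>, the substitution amounts to overriding the
  assignment.\<close>

lemma sat_inst_fm:
  "sat (named M) s (inst_fm \<phi> e) \<longleftrightarrow> sat M (\<lambda>n. case e n of None \<Rightarrow> s n | Some c \<Rightarrow> c) \<phi>"
proof (induction \<phi> arbitrary: s e)
  case (Rel r ts)
  have "map (tval (named M) s) (map (inst_tm e) ts) =
      map (tval M (\<lambda>n. case e n of None \<Rightarrow> s n | Some c \<Rightarrow> c)) ts"
    by (simp add: tval_inst_tm)
  moreover have "rint (named M) = rint M"
    by (simp add: named_def)
  ultimately show ?case by (simp only: sat.simps inst_fm.simps)
next
  case (Ex m \<phi>)
  \<comment> \<open>The bound variable must keep its quantified value, so erasing \<open>m\<close>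
    from \<open>e\<close> corresponds to updating the overridden assignment at
    \<open>m\<close>.\<close>
  have "(\<lambda>n. case (e(m := None)) n of None \<Rightarrow> (s(m := a)) n | Some c \<Rightarrow> c) =
      (\<lambda>n. case e n of None \<Rightarrow> s n | Some c \<Rightarrow> c)(m := a)" for a
    by (rule ext) (simp split: option.split)
  then show ?case by (simp add: Ex.IH) (simp add: named_def)
qed (simp_all add: tval_inst_tm)

lemma is_tm_inst_tm:
  "ran e \<subseteq> A \<Longrightarrow> is_tm L t \<Longrightarrow> is_tm (lang_over L A) (inst_tm e t)"
  by (induction t) (auto simp: lang_over_def ran_def split: option.split)

lemma is_fm_inst_fm:
  "ran e \<subseteq> A \<Longrightarrow> is_fm L \<phi> \<Longrightarrow> is_fm (lang_over L A) (inst_fm \<phi> e)"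
proof (induction \<phi> arbitrary: e)
  case (Rel r ts)
  then show ?case
    using is_tm_inst_tm[of e A L] by (auto simp: lang_over_def)
next
  case (Ex n \<phi>)
  have "ran (e(n := None)) \<subseteq> A"
    using Ex.prems(1) by (auto simp: ran_def)
  then show ?case using Ex by simp
qed (auto intro: is_tm_inst_tm)

lemma fvt_inst_tm: "fvt (inst_tm e t) = fvt t - dom e"
  by (induction t) (auto split: option.splits)

lemma fv_inst_fm: "fv (inst_fm \<phi> e) = fv \<phi> - dom e"
  by (induction \<phi> arbitrary: e) (auto simp: fvt_inst_tm)

section \<open>Realized formulas do not fork\<close>

lemma not_divides_if_realized:
  fixes C :: "('f, 'r, 'c) struct"
  assumes "A \<subseteq> univ C" "a \<in> A" and real: "sat (named C) (\<lambda>_. a) (inst \<chi> bs)"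
  shows "\<not> divides L C A \<chi> bs"
proof
  assume div: "divides L C A \<chi> bs"
  then have fm: "is_fm L \<chi>" "fv \<chi> \<subseteq> {0..length bs}"
    by (simp_all add: divides_def)
  from div obtain k and c :: "nat \<Rightarrow> 'c list"
    where c: "\<forall>i. set (c i) \<subseteq> univ C \<and> same_type L C A bs (c i)"
    and incons: "\<forall>I. finite I \<and> card I = k \<longrightarrow>
      \<not> (\<exists>a\<in>univ C. \<forall>i\<in>I. sat (named C) (\<lambda>_. a) (inst \<chi> (c i)))"
    unfolding divides_def by (elim conjE exE) (rule that)
  \<comment> \<open>This is \<chi>(a, ys) with \<open>a\<close> as a parameter: its free variables
    are among those of the tuple, the shape of formula that \<open>same_type\<close>
    compares.\<close>
  define \<theta> where "\<theta> = inst_fm \<chi> [0 \<mapsto> a]"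
  have \<theta>: "is_fm (lang_over L A) \<theta>" "fv \<theta> \<subseteq> {1..length bs}"
  proof -
    show "is_fm (lang_over L A) \<theta>"
      unfolding \<theta>_def using fm(1) \<open>a \<in> A\<close> by (intro is_fm_inst_fm) auto
    have "{0..length bs} - {0} = {1..length bs}" by auto
    then show "fv \<theta> \<subseteq> {1..length bs}"
      unfolding \<theta>_def fv_inst_fm using fm(2) by auto
  qed
  have inst: "sat (named C) (\<lambda>_. a) (inst \<chi> ds) \<longleftrightarrow> sat (named C) (tup ds) \<theta>"
    if "length ds = length bs" for ds
    unfolding inst_def \<theta>_def sat_inst_fm
  \<comment> \<open>The two assignments may differ beyond index \<open>length bs\<close>, where the
    left one gives \<open>a\<close> and \<open>tup\<close> runs off the list; the bound on
    \<open>fv \<chi>\<close> excludes these indices.\<close>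
  proof (rule sat_cong)
    fix n assume "n \<in> fv \<chi>"
    with fm(2) have "n \<le> length bs" by auto
    then show "(case if 1 \<le> n \<and> n \<le> length ds then Some (tup ds n) else None of
        None \<Rightarrow> a | Some c \<Rightarrow> c) = (case [0 \<mapsto> a] n of None \<Rightarrow> tup ds n | Some c \<Rightarrow> c)"
      using that by auto
  qed
  have "sat (named C) (\<lambda>_. a) (inst \<chi> (c i))" for i
  proof -
    have "length (c i) = length bs" "sat (named C) (tup bs) \<theta> \<longleftrightarrow> sat (named C) (tup (c i)) \<theta>"
      using c[rule_format, of i] \<theta> by (simp_all add: same_type_def)
    then show ?thesis using real inst[of bs] inst[of "c i"] by simp
  qed
  then show False
    \<comment> \<open>The single element \<open>a\<close> satisfies all the conjugates, so the first
      \<open>k\<close> of them already refute k-inconsistency.\<close>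
    using incons[rule_format, of "{..<k}"] assms(1,2) by auto
qed

lemma elem_ext_refl: "is_model L T C \<Longrightarrow> A \<subseteq> univ C \<Longrightarrow> elem_ext L T C A C"
  by (simp add: elem_ext_def)

text \<open>\<open>C\<close> is itself one of the models over which entailment ranges, and a
  constant assignment stays in its universe.\<close>

lemma entails_sat:
  assumes "is_model L T C" "A \<subseteq> univ C" "entails L T C A \<phi>" "a \<in> univ C"
  shows "sat (named C) (\<lambda>_. a) \<phi>"
  using assms elem_ext_refl[OF assms(1,2)] by (auto simp: entails_def)

text \<open>An element of \<open>A\<close> realizing \<phi> would realize one of the dividing
  disjuncts that \<phi> implies, which the previous case of a single dividing formula rules
  out.\<close>

lemma not_forks_if_realized:
  assumes "is_model L T C" "A \<subseteq> univ C" "a \<in> A" "sat (named C) (\<lambda>_. a) \<phi>"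
  shows "\<not> forks L T C A \<phi>"
proof
  assume "forks L T C A \<phi>"
  then obtain ds where ds: "\<forall>(\<chi>, bs)\<in>set ds. divides L C A \<chi> bs"
    and ent: "entails L T C (univ C) (Imp \<phi> (Disj (map (\<lambda>(\<chi>, bs). inst \<chi> bs) ds)))"
    unfolding forks_def by blast
  have "a \<in> univ C" using assms(2,3) by blast
  from entails_sat[OF assms(1) order_refl ent this] assms(4)
  obtain \<chi> bs where "(\<chi>, bs) \<in> set ds" "sat (named C) (\<lambda>_. a) (inst \<chi> bs)"
    by auto
  moreover from this(1) ds have "divides L C A \<chi> bs" by blast
  ultimately show False using not_divides_if_realized[OF assms(2,3)] by metis
qed

section \<open>Heirs\<close>

lemma self_in_cls: "\<phi> \<in> forms L A \<Longrightarrow> \<phi> \<in> cls L T C A \<phi>"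
  by (simp add: cls_def form_equiv_def entails_def)

lemma cls_in_form_alg: "\<phi> \<in> forms L A \<Longrightarrow> cls L T C A \<phi> \<in> form_alg L T C A"
  by (simp add: cls_def form_alg_def quotientI)

text \<open>Every class in the algebra has a representative, so membership of formulas determines a
  filter of classes.\<close>

lemma filter_eqI:
  assumes "form_filter L T C A p" "form_filter L T C A q"
    and "\<And>\<phi>. mem L T C A \<phi> p \<longleftrightarrow> mem L T C A \<phi> q"
  shows "p = q"
proof -
  have "X \<in> p \<longleftrightarrow> X \<in> q" if X: "X \<in> form_alg L T C A" for X
  proof -
    obtain \<phi> where "\<phi> \<in> forms L A" "X = cls L T C A \<phi>"
      using X by (auto simp: form_alg_def cls_def elim: quotientE)
    then show ?thesis using assms(3)[of \<phi>] by (simp add: mem_def)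
  qed
  then show ?thesis using assms(1,2) by (auto simp: form_filter_def)
qed

definition generated_filter :: "('f, 'r) lang \<Rightarrow> ('f, 'r) fm set \<Rightarrow> ('f, 'r, 'c) struct \<Rightarrow>
    'c set \<Rightarrow> ('f + 'c, 'r) fm set set \<Rightarrow> 'c set \<Rightarrow> ('f + 'c, 'r) fm set set" where
  "generated_filter L T C A p B = cls L T C B `
     {\<phi> \<in> forms L B. \<exists>\<psi>. mem L T C A \<psi> p \<and> entails L T C B (Imp \<psi> \<phi>)}"

text \<open>A class in the image only provides some formula \<phi>' equivalent to \<phi> with a
  premise in \<open>p\<close>; transporting the entailment along the equivalence makes the criterion
  independent of the representative.\<close>

lemma mem_generated_filter:
  "mem L T C B \<phi> (generated_filter L T C A p B) \<longleftrightarrow>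
     \<phi> \<in> forms L B \<and> (\<exists>\<psi>. mem L T C A \<psi> p \<and> entails L T C B (Imp \<psi> \<phi>))"
proof
  assume mem: "mem L T C B \<phi> (generated_filter L T C A p B)"
  then obtain \<phi>' \<psi> where *: "\<phi> \<in> forms L B" "\<phi>' \<in> forms L B" "cls L T C B \<phi> = cls L T C B \<phi>'"
      "mem L T C A \<psi> p" "entails L T C B (Imp \<psi> \<phi>')"
    by (auto simp: mem_def generated_filter_def)
  from self_in_cls[OF *(2)] *(3) have "\<phi>' \<in> cls L T C B \<phi>" by blast
  then have "entails L T C B (Iff \<phi> \<phi>')"
    by (simp add: cls_def form_equiv_def)
  with *(5) have "entails L T C B (Imp \<psi> \<phi>)"
    unfolding entails_def by simp
  with * show "\<phi> \<in> forms L B \<and> (\<exists>\<psi>. mem L T C A \<psi> p \<and> entails L T C B (Imp \<psi> \<phi>))"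
    by blast
qed (auto simp: mem_def generated_filter_def)

lemma form_filter_generated_filter:
  assumes "form_filter L T C A p"
  shows "form_filter L T C B (generated_filter L T C A p B)"
  unfolding form_filter_def
proof (intro conjI allI impI)
  show "generated_filter L T C A p B \<subseteq> form_alg L T C B"
    by (auto simp: generated_filter_def cls_in_form_alg)
next
  fix \<phi>s assume "\<forall>\<phi>\<in>set \<phi>s. mem L T C B \<phi> (generated_filter L T C A p B)"
  \<comment> \<open>For closure under conjunction, choose a premise from \<open>p\<close> for each
    conjunct; the conjunction of these premises lies in \<open>p\<close> and implies the conjunction
    sought.\<close>
  then obtain f where forms: "set \<phi>s \<subseteq> forms L B"
    and f: "\<And>\<phi>. \<phi> \<in> set \<phi>s \<Longrightarrow> mem L T C A (f \<phi>) p \<and> entails L T C B (Imp (f \<phi>) \<phi>)"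
    unfolding mem_generated_filter by (metis subsetI)
  have "\<forall>\<psi>\<in>set (map f \<phi>s). mem L T C A \<psi> p"
    using f by simp
  then have "mem L T C A (Conj (map f \<phi>s)) p"
    using assms unfolding form_filter_def by blast
  moreover have "entails L T C B (Imp (Conj (map f \<phi>s)) (Conj \<phi>s))"
    using f by (simp add: entails_def)
  ultimately show "mem L T C B (Conj \<phi>s) (generated_filter L T C A p B)"
    unfolding mem_generated_filter using Conj_in_forms[OF forms] by blast
next
  fix \<phi> \<psi>
  assume "mem L T C B \<phi> (generated_filter L T C A p B) \<and> \<psi> \<in> forms L B \<and> entails L T C B (Imp \<phi> \<psi>)"
  then show "mem L T C B \<psi> (generated_filter L T C A p B)"
    unfolding mem_generated_filter entails_def sat_Imp by blast
qed

text \<open>Being implied by formulas of \<open>p\<close> puts an heir inside the generated filter;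
  extending \<open>p\<close> and being closed under weaker formulas over \<open>B\<close> gives the
  reverse inclusion.\<close>

lemma heir_iff_generated_filter:
  assumes p: "form_filter L T C A p" and "A \<subseteq> B"
  shows "heir L T C A p B q \<longleftrightarrow> q = generated_filter L T C A p B"
proof
  assume heir: "heir L T C A p B q"
  then have "mem L T C B \<phi> q \<longleftrightarrow> mem L T C B \<phi> (generated_filter L T C A p B)" for \<phi>
    unfolding mem_generated_filter heir_def form_filter_def by (meson mem_def)
  then show "q = generated_filter L T C A p B"
    using heir filter_eqI[OF _ form_filter_generated_filter[OF p]] by (auto simp: heir_def)
next
  assume q: "q = generated_filter L T C A p B"
  have "mem L T C B \<phi> q" if "mem L T C A \<phi> p" for \<phi>
  proof -
    have "entails L T C B (Imp \<phi> \<phi>)" by (simp add: entails_def)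
    then show ?thesis
      unfolding q mem_generated_filter
      using that forms_mono[OF \<open>A \<subseteq> B\<close>, of L] by (auto simp: mem_def)
  qed
  then show "heir L T C A p B q"
    using form_filter_generated_filter[OF p] by (auto simp: heir_def q mem_generated_filter)
qed

lemma nonforking_generated_filter:
  assumes model: "is_model L T C" and "A \<subseteq> B" "B \<subseteq> univ C" and "fin_sat C A p"
  shows "nonforking L T C A B (generated_filter L T C A p B)"
  unfolding nonforking_def mem_generated_filter
proof (intro allI impI)
  fix \<phi> assume "\<phi> \<in> forms L B \<and> (\<exists>\<psi>. mem L T C A \<psi> p \<and> entails L T C B (Imp \<psi> \<phi>))"
  then obtain \<psi> where \<psi>: "mem L T C A \<psi> p" "entails L T C B (Imp \<psi> \<phi>)"
    by blast
  \<comment> \<open>\<open>fin_sat\<close> speaks of classes, so it is applied to the singleton of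
    the class of \<psi>; the element obtained satisfies the whole class, hence \<psi>.\<close>
  then have "finite {cls L T C A \<psi>} \<and> {cls L T C A \<psi>} \<subseteq> p" and "\<psi> \<in> cls L T C A \<psi>"
    by (auto simp: mem_def intro: self_in_cls)
  then obtain a where a: "a \<in> A" "sat (named C) (\<lambda>_. a) \<psi>"
    using \<open>fin_sat C A p\<close> unfolding fin_sat_def by (metis singletonI)
  then have "sat (named C) (\<lambda>_. a) \<phi>"
    using entails_sat[OF model \<open>B \<subseteq> univ C\<close> \<psi>(2), of a] assms(2,3) by auto
  then show "\<not> forks L T C A \<phi>"
    using not_forks_if_realized[OF model _ a(1)] assms(2,3) by blast
qed

text \<open>The set of indices at which a class belongs to \<open>p\<close> is either all of
  \<open>Field \<mu>\<close>, which is in \<open>U\<close>, or empty, which is not.\<close>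

lemma ultra_power_eq:
  assumes "ultrafilter_on (Field \<mu>) U" and "p \<subseteq> form_alg L T C A"
  shows "ultra_power L T C A \<mu> U p = p"
  using assms by (auto simp: ultra_power_def ultra_limit_def ultrafilter_on_def)

theorem proposition4p3:
  fixes L :: "('f, 'r) lang" and T :: "('f, 'r) fm set"
    and \<kappa> :: "'k rel" and C :: "('f, 'r, 'c) struct" and A :: "'c set"
    and \<mu> :: "'i rel" and U :: "'i set set"
    and p :: "('f + 'c, 'r) fm set set"
  assumes "countable_lang L"
    and "complete_theory L T"
    and "monster L T \<kappa> C"
    and "A \<subseteq> univ C"
    and "regular_ultrafilter \<mu> U"
    and "fn_basis L T C A p"
    and "flat L T C A p"
    and "definable L T C A p"
    and "property_B L T C A p"
  shows "flat L T C A (ultra_power L T C A \<mu> U p) \<and>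
    (\<forall>B. A \<subseteq> B \<and> B \<subseteq> univ C \<longrightarrow>
      (\<exists>!q. heir L T C A (ultra_power L T C A \<mu> U p) B q \<and> nonforking L T C A B q))"
proof -
  have p: "form_filter L T C A p" "fin_sat C A p" and model: "is_model L T C"
    using assms(3,6) by (auto simp: fn_basis_def monster_def)
  have eq: "ultra_power L T C A \<mu> U p = p"
    using assms(5) p(1) by (intro ultra_power_eq) (auto simp: regular_ultrafilter_def form_filter_def)
  \<comment> \<open>The generated filter is the only heir at all, and it does not fork; existence
    and uniqueness both follow.\<close>
  have "\<exists>!q. heir L T C A p B q \<and> nonforking L T C A B q" if "A \<subseteq> B" "B \<subseteq> univ C" for B
    using heir_iff_generated_filter[OF p(1) that(1)] nonforking_generated_filter[OF model that p(2)]
    by auto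
  then show ?thesis
    using assms(7) by (simp add: eq)
qed

end
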